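(* Let $G=(V,E)$ be a connected graph, $v\in V$, and let $a^{\mathsf T}x\le b$ be facet-defining for $\textsc{Bond}(G)$. Obtain $\bar G=(\bar V,\bar E)$ from $G$ by replacing $v$ by a triangle on new vertices $v_1,v_2,v_3$ and distributing the edges incident to $v$ arbitrarily among $v_1,v_2,v_3$. Define $\varphi:\bar E\setminus\{v_1v_2,v_1v_3,v_2v_3\}\to E$ by $\varphi(e)=e$ if $v_1,v_2,v_3\notin e$ and $\varphi(e)=vw$ if $e=v_iw$ ($i\in[3]$). Consider the edge weights on $\bar E$ that are $0$ on the three triangle edges $v_jv_k$ and $a_{\varphi(e)}$ on every other edge $e$. For $i=1,2,3$ let $S_i\subseteq\bar V$ with $S_i\cap\{v_1,v_2,v_3\}=\{v_i\}$ be such that $\delta_{\bar G}(S_i)$ is a bond of maximum weight (w.r.t. these weights) among bonds of this form, and let $\omega_i$ be its weight. Define $\bar a\in\mathbb{R}^{\bar E}$ by $\bar a_e=a_{\varphi(e)}$ for non-triangle edges $e$, $\bar a_{v_1v_2}=\tfrac12(b-\omega_1-\omega_2+\omega_3)$, $\bar a_{v_1v_3}=\tfrac12(b-\omega_1+\omega_2-\omega_3)$, $\bar a_{v_2v_3}=\tfrac12(b+\omega_1-\omega_2-\omega_3)$. Then $\bar a^{\mathsf T}x\le b$ defines a facet of $\textsc{Bond}(\bar G)$.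
   Context: For a graph $G=(V,E)$ and $S\subseteq V$, the cut $\delta_G(S)=\{e\in E:|e\cap S|=1\}$ is a bond if $G[S]$ and $G[V\setminus S]$ are connected. The weight of a bond $\delta$ w.r.t. weights $c$ is $\sum_{e\in\delta}c_e$. $x^\delta$ is the incidence vector, $\textsc{Bond}(G)=\mathrm{conv}\{x^\delta:\delta\text{ a bond}\}$. *)

theory Defs
  imports "HOL-Analysis.Analysis"
begin

definition simple_graph :: "'v set \<Rightarrow> 'v set set \<Rightarrow> bool" where
  "simple_graph V E \<longleftrightarrow> finite V \<and> (\<forall>e\<in>E. e \<subseteq> V \<and> card e = 2)"

text \<open>The graph without vertices counts as connected, so in a connected graph the empty cut
  is a bond (take the vertex set \<open>S = {}\<close>) and the origin belongs to the bond polytope.\<close>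

definition connected_graph :: "'v set \<Rightarrow> 'v set set \<Rightarrow> bool" where
  "connected_graph V E \<longleftrightarrow> (\<forall>u\<in>V. \<forall>w\<in>V. (u, w) \<in> {(x, y). {x, y} \<in> E}\<^sup>*)"

definition induced_edges :: "'v set set \<Rightarrow> 'v set \<Rightarrow> 'v set set" where
  "induced_edges E S = {e \<in> E. e \<subseteq> S}"

definition cut :: "'v set set \<Rightarrow> 'v set \<Rightarrow> 'v set set" where
  "cut E S = {e \<in> E. card (e \<inter> S) = 1}"

text \<open>The predicate \<open>cut_is_bond V E S\<close> says that the cut \<open>cut E S\<close> is a bond.\<close>

definition cut_is_bond :: "'v set \<Rightarrow> 'v set set \<Rightarrow> 'v set \<Rightarrow> bool" where
  "cut_is_bond V E S \<longleftrightarrow> S \<subseteq> V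
     \<and> connected_graph S (induced_edges E S)
     \<and> connected_graph (V - S) (induced_edges E (V - S))"

definition bonds :: "'v set \<Rightarrow> 'v set set \<Rightarrow> 'v set set set" where
  "bonds V E = {cut E S |S. cut_is_bond V E S}"

definition cut_weight :: "'v set set \<Rightarrow> ('v set \<Rightarrow> real) \<Rightarrow> 'v set \<Rightarrow> real" where
  "cut_weight E c S = (\<Sum>e\<in>cut E S. c e)"

text \<open>The space of real vectors indexed by \<open>E\<close> is realised as the coordinate subspace of
  \<open>real ^ ('v set)\<close> of vectors vanishing outside \<open>E\<close>; it contains all incidence vectors of
  subsets of \<open>E\<close>. Faces and dimensions of a polytope in it do not depend on the ambient
  space.\<close>

definition incidence_vector :: "'v::finite set set \<Rightarrow> real ^ ('v set)" where
  "incidence_vector D = (\<chi> e. if e \<in> D then 1 else 0)"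

definition bond_polytope :: "'v::finite set \<Rightarrow> 'v set set \<Rightarrow> (real ^ ('v set)) set" where
  "bond_polytope V E = convex hull (incidence_vector ` bonds V E)"

text \<open>Coefficient vectors are functions of which only the values on \<open>E\<close> are used.\<close>

definition facet_defining ::
    "'v::finite set \<Rightarrow> 'v set set \<Rightarrow> ('v set \<Rightarrow> real) \<Rightarrow> real \<Rightarrow> bool" where
  "facet_defining V E a b \<longleftrightarrow>
     (\<forall>x\<in>bond_polytope V E. (\<Sum>e\<in>E. a e * x $ e) \<le> b) \<and>
     {x \<in> bond_polytope V E. (\<Sum>e\<in>E. a e * x $ e) = b} facet_of bond_polytope V E"

text \<open>Replacing \<open>v\<close> by a triangle: for every neighbour \<open>w\<close> of \<open>v\<close>, the vertex \<open>f w\<close> is the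
  triangle vertex that receives the edge \<open>{v, w}\<close>.\<close>

definition triangle :: "'v \<Rightarrow> 'v \<Rightarrow> 'v \<Rightarrow> 'v set set" where
  "triangle v1 v2 v3 = {{v1, v2}, {v1, v3}, {v2, v3}}"

definition split_verts :: "'v set \<Rightarrow> 'v \<Rightarrow> 'v \<Rightarrow> 'v \<Rightarrow> 'v \<Rightarrow> 'v set" where
  "split_verts V v v1 v2 v3 = (V - {v}) \<union> {v1, v2, v3}"

definition split_edges ::
    "'v set set \<Rightarrow> 'v \<Rightarrow> 'v \<Rightarrow> 'v \<Rightarrow> 'v \<Rightarrow> ('v \<Rightarrow> 'v) \<Rightarrow> 'v set set" where
  "split_edges E v v1 v2 v3 f =
     {e \<in> E. v \<notin> e} \<union> {{f w, w} |w. {v, w} \<in> E} \<union> triangle v1 v2 v3"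

definition split_phi :: "'v \<Rightarrow> 'v \<Rightarrow> 'v \<Rightarrow> 'v \<Rightarrow> 'v set \<Rightarrow> 'v set" where
  "split_phi v v1 v2 v3 e =
     (if e \<inter> {v1, v2, v3} = {} then e else insert v (e - {v1, v2, v3}))"

definition split_weight ::
    "'v \<Rightarrow> 'v \<Rightarrow> 'v \<Rightarrow> 'v \<Rightarrow> ('v set \<Rightarrow> real) \<Rightarrow> 'v set \<Rightarrow> real" where
  "split_weight v v1 v2 v3 a e =
     (if e \<in> triangle v1 v2 v3 then 0 else a (split_phi v v1 v2 v3 e))"

definition lifted_coeff ::
    "'v \<Rightarrow> 'v \<Rightarrow> 'v \<Rightarrow> 'v \<Rightarrow> ('v set \<Rightarrow> real) \<Rightarrow> real \<Rightarrow> real \<Rightarrow> real \<Rightarrow> real \<Rightarrow> 'v set \<Rightarrow> real" where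
  "lifted_coeff v v1 v2 v3 a b \<omega>1 \<omega>2 \<omega>3 e =
     (if e = {v1, v2} then (b - \<omega>1 - \<omega>2 + \<omega>3) / 2
      else if e = {v1, v3} then (b - \<omega>1 + \<omega>2 - \<omega>3) / 2
      else if e = {v2, v3} then (b + \<omega>1 - \<omega>2 - \<omega>3) / 2
      else a (split_phi v v1 v2 v3 e))"

end

theory Submission
  imports Defs
begin

text \<open>Up to complementation, a bond of the split graph either avoids the triangle vertices, and is
  then a bond of \<open>G\<close> avoiding \<open>v\<close>, or separates exactly one \<open>v\<^sub>i\<close> from the other two. In the
  first case its lifted weight is its weight in \<open>G\<close>; in the second the two triangle edges
  at \<open>v\<^sub>i\<close> contribute \<open>b - \<omega>\<^sub>i\<close>. Hence the lifted inequality is valid, and it is tight at the three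
  bonds \<open>S\<^sub>i\<close> and at all lifts of points of the given facet. The lifts vanish on the triangle, where
  the \<open>S\<^sub>i\<close> have the linearly independent restrictions \<open>(1,1,0)\<close>, \<open>(1,0,1)\<close>, \<open>(0,1,1)\<close>, so the
  dimension of the face grows by at least three, which is the number of new edges. This suffices
  because the bond polytope of a connected graph is full-dimensional: every cut is an edge-disjoint
  union of bonds, and cuts span the edge space.\<close>

section \<open>Connectivity\<close>

text \<open>Walks map to walks under \<open>h\<close>, because each edge becomes a walk in the
  target. Two vertices of \<open>B\<close> are joined by walking to images of vertices of
  \<open>A\<close>, following the mapped walk between these, and reversing the last piece by
  symmetry.\<close>

lemma connected_graph_transfer:
  assumes "connected_graph A E"
    and edge: "\<And>x y. {x, y} \<in> E \<Longrightarrow> (h x, h y) \<in> {(x, y). {x, y} \<in> F}\<^sup>*"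
    and surj: "\<And>z. z \<in> B \<Longrightarrow> \<exists>x\<in>A. (z, h x) \<in> {(x, y). {x, y} \<in> F}\<^sup>*"
  shows "connected_graph B F"
  unfolding connected_graph_def
proof (intro ballI)
  fix y z assume "y \<in> B" "z \<in> B"
  let ?R = "{(x, y). {x, y} \<in> F}"
  have "sym (?R\<^sup>*)"
    by (intro sym_rtrancl) (auto simp: sym_def insert_commute)
  moreover obtain p q where "p \<in> A" "q \<in> A" "(y, h p) \<in> ?R\<^sup>*" "(z, h q) \<in> ?R\<^sup>*"
    using surj \<open>y \<in> B\<close> \<open>z \<in> B\<close> by meson
  moreover have "(h p, h q) \<in> ?R\<^sup>*"
  proof -
    have "(p, q) \<in> {(x, y). {x, y} \<in> E}\<^sup>*"
      using assms(1) \<open>p \<in> A\<close> \<open>q \<in> A\<close> unfolding connected_graph_def by blast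
    then show ?thesis
      by induction (use edge in \<open>auto intro: rtrancl_trans\<close>)
  qed
  ultimately show "(y, z) \<in> ?R\<^sup>*"
    by (meson rtrancl_trans symD)
qed

text \<open>\<open>A\<close> is the component of a vertex \<open>u\<close> from which some vertex of
  \<open>S\<close> cannot be reached, and \<open>B\<close> is the rest of \<open>S\<close>.\<close>

lemma disconnected_splitE:
  assumes "\<not> connected_graph S (induced_edges E S)"
  obtains A B where "A \<union> B = S" "A \<inter> B = {}" "A \<noteq> {}" "B \<noteq> {}"
    "\<And>x y. x \<in> A \<Longrightarrow> y \<in> B \<Longrightarrow> {x, y} \<notin> E"
proof -
  let ?R = "{(x, y). {x, y} \<in> induced_edges E S}"
  obtain u w where uw: "u \<in> S" "w \<in> S" "(u, w) \<notin> ?R\<^sup>*"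
    using assms unfolding connected_graph_def by blast
  define A where "A = {x \<in> S. (u, x) \<in> ?R\<^sup>*}"
  have "{x, y} \<notin> E" if "x \<in> A" "y \<in> S - A" for x y
  proof
    assume "{x, y} \<in> E"
    then have "(x, y) \<in> ?R"
      using that by (auto simp: A_def induced_edges_def)
    then show False
      using that by (auto simp: A_def intro: rtrancl_into_rtrancl)
  qed
  then show ?thesis
    using uw by (intro that[of A "S - A"]) (auto simp: A_def)
qed

text \<open>Follow a walk in the whole graph from a vertex of \<open>B\<close> towards
  \<open>S\<close>. As no edge joins \<open>A\<close> to \<open>B\<close>, it can leave
  \<open>B\<close> only by entering \<open>S\<close>, so its initial piece stays inside
  \<open>S \<union> B\<close> and attaches the vertex to the connected set \<open>S\<close>.\<close>

lemma connected_graph_Un_complement_part: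
  assumes G: "connected_graph V E" "\<And>e. e \<in> E \<Longrightarrow> e \<subseteq> V"
    and S: "connected_graph S (induced_edges E S)" "S \<noteq> {}"
    and AB: "A \<union> B = V - S" "S \<subseteq> V" "\<And>x y. x \<in> A \<Longrightarrow> y \<in> B \<Longrightarrow> {x, y} \<notin> E"
  shows "connected_graph (S \<union> B) (induced_edges E (S \<union> B))"
proof -
  let ?R = "{(x, y). {x, y} \<in> E}"
  let ?Q = "{(x, y). {x, y} \<in> induced_edges E (S \<union> B)}"
  have reach: "\<exists>s\<in>S. (z, s) \<in> ?Q\<^sup>*" if z: "z \<in> B" for z
  proof -
    obtain s where s: "s \<in> S" using S by blast
    have "(z, s) \<in> ?R\<^sup>*"
      using G s z AB unfolding connected_graph_def by blast
    then show ?thesis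
      using s z
    proof (induction rule: converse_rtrancl_induct)
      case base
      then show ?case by blast
    next
      case (step y z)
      then have e: "{y, z} \<in> E" by simp
      then have "z \<in> V" "{z, y} \<in> E" using G(2) by (auto simp: insert_commute)
      then have z: "z \<in> S \<union> B"
        using AB step.prems by blast
      then have yz: "(y, z) \<in> ?Q"
        using e step.prems by (auto simp: induced_edges_def)
      show ?case
      proof (cases "z \<in> S")
        case True
        then show ?thesis using yz by blast
      next
        case False
        then obtain s' where "s' \<in> S" "(z, s') \<in> ?Q\<^sup>*" using z step by blast
        then show ?thesis using yz by (meson converse_rtrancl_into_rtrancl)
      qed
    qed
  qed
  show ?thesis
  proof (rule connected_graph_transfer[OF S(1), where h = "\<lambda>x. x"])
    fix x y assume "{x, y} \<in> induced_edges E S"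
    then show "(x, y) \<in> ?Q\<^sup>*" by (auto simp: induced_edges_def)
  qed (use reach in blast)
qed

section \<open>The bond polytope is full-dimensional\<close>

lemma simple_graph_edgeE:
  assumes "simple_graph V E" "e \<in> E"
  obtains x y where "e = {x, y}" "x \<noteq> y" "x \<in> V" "y \<in> V"
  using assms unfolding simple_graph_def by (metis card_2_iff insert_subset)

lemma card_doubleton_Int_eq_1_iff:
  assumes "x \<noteq> y"
  shows "card ({x, y} \<inter> S) = 1 \<longleftrightarrow> (x \<in> S) \<noteq> (y \<in> S)"
  using assms by (cases "x \<in> S"; cases "y \<in> S") auto

lemma incidence_cut_nth:
  fixes x y :: "'v::finite"
  assumes "{x, y} \<in> E" "x \<noteq> y"
  shows "incidence_vector (cut E S) $ {x, y} = (if (x \<in> S) \<noteq> (y \<in> S) then 1 else 0)"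
  unfolding incidence_vector_def cut_def vec_lambda_beta mem_Collect_eq
    card_doubleton_Int_eq_1_iff[OF assms(2)]
  using assms(1) by simp

lemma cut_complement:
  assumes "simple_graph V E"
  shows "cut E (V - S) = cut E S"
proof -
  have "card (e \<inter> (V - S)) = 1 \<longleftrightarrow> card (e \<inter> S) = 1" if "e \<in> E" for e
  proof -
    obtain x y where xy: "e = {x, y}" "x \<noteq> y" "x \<in> V" "y \<in> V"
      using assms \<open>e \<in> E\<close> by (rule simple_graph_edgeE)
    then show ?thesis unfolding xy(1) card_doubleton_Int_eq_1_iff[OF xy(2)] by blast
  qed
  then show ?thesis unfolding cut_def by blast
qed

lemma cut_is_bond_complement:
  assumes "cut_is_bond V E S"
  shows "cut_is_bond V E (V - S)"
  using assms by (simp add: cut_is_bond_def double_diff)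

text \<open>An edge in both \<open>cut E A\<close> and \<open>cut E B\<close>, or one that leaves
  \<open>A\<close> but not \<open>A \<union> B\<close>, would join \<open>A\<close> to
  \<open>B\<close>.\<close>

lemma incidence_cut_Un:
  fixes V :: "'v::finite set"
  assumes "simple_graph V E" "A \<inter> B = {}" "\<And>x y. x \<in> A \<Longrightarrow> y \<in> B \<Longrightarrow> {x, y} \<notin> E"
  shows "incidence_vector (cut E (A \<union> B)) = incidence_vector (cut E A) + incidence_vector (cut E B)"
proof -
  have "(if e \<in> cut E (A \<union> B) then 1 else 0 :: real)
      = (if e \<in> cut E A then 1 else 0) + (if e \<in> cut E B then 1 else 0)" for e
  proof (cases "e \<in> E")
    case True
    then obtain x y where xy: "e = {x, y}" "x \<noteq> y"
      using assms(1) simple_graph_edgeE by metis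
    then have "\<not> (x \<in> A \<and> y \<in> B)" "\<not> (y \<in> A \<and> x \<in> B)"
      using assms(3)[of x y] assms(3)[of y x] True by (auto simp: insert_commute)
    then show ?thesis
      using True assms(2) unfolding cut_def xy mem_Collect_eq card_doubleton_Int_eq_1_iff[OF xy(2)]
      by auto
  qed (simp add: cut_def)
  then show ?thesis
    by (simp add: vec_eq_iff incidence_vector_def)
qed

context
  fixes V :: "'v::finite set" and E :: "'v set set"
  assumes simple: "simple_graph V E" and connected: "connected_graph V E"
begin

text \<open>Induction on the size of the complement. If the complement is disconnected, it splits
  into \<open>A\<close> and \<open>B\<close> without edges between them, and the cut of
  \<open>S\<close> is the sum of the cuts of \<open>A\<close> and \<open>B\<close>. These are also
  the cuts of the connected sets \<open>S \<union> B\<close> and \<open>S \<union> A\<close>, whose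
  complements are smaller.\<close>

lemma incidence_cut_connected_in_span_bonds:
  assumes "S \<subseteq> V" "connected_graph S (induced_edges E S)"
  shows "incidence_vector (cut E S) \<in> span (incidence_vector ` bonds V E)"
  using assms
proof (induction "card (V - S)" arbitrary: S rule: less_induct)
  case less
  show ?case
  proof (cases "connected_graph (V - S) (induced_edges E (V - S))")
    case True
    then have "cut E S \<in> bonds V E"
      using less.prems unfolding bonds_def cut_is_bond_def by blast
    then show ?thesis by (intro span_base imageI)
  next
    case False
    then obtain A B where AB: "A \<union> B = V - S" "A \<inter> B = {}" "A \<noteq> {}" "B \<noteq> {}"
      "\<And>x y. x \<in> A \<Longrightarrow> y \<in> B \<Longrightarrow> {x, y} \<notin> E"
      by (rule disconnected_splitE) blast
    have EV: "e \<subseteq> V" if "e \<in> E" for e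
      using simple that by (auto simp: simple_graph_def)
    then have "induced_edges E V = E" by (auto simp: induced_edges_def)
    \<comment> \<open>For empty \<open>S\<close> the complement would be all of \<open>V\<close>,
      which is connected.\<close>
    then have "S \<noteq> {}" using False connected by auto
    \<comment> \<open>Stated for arbitrary \<open>C\<close> and \<open>D\<close> because the two
      parts are used in both roles.\<close>
    have sub: "incidence_vector (cut E C) \<in> span (incidence_vector ` bonds V E)"
      if "C \<union> D = V - S" "C \<inter> D = {}" "D \<noteq> {}" "\<And>x y. x \<in> C \<Longrightarrow> y \<in> D \<Longrightarrow> {x, y} \<notin> E" for C D
    proof -
      have "connected_graph (S \<union> D) (induced_edges E (S \<union> D))"
        by (rule connected_graph_Un_complement_part)
          (use connected EV less.prems \<open>S \<noteq> {}\<close> that in auto)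
      moreover have "V - (S \<union> D) \<subset> V - S" using that by blast
      then have "card (V - (S \<union> D)) < card (V - S)" by (intro psubset_card_mono) auto
      moreover have "S \<union> D \<subseteq> V" using that less.prems by blast
      ultimately have "incidence_vector (cut E (S \<union> D)) \<in> span (incidence_vector ` bonds V E)"
        by (intro less.hyps)
      moreover have "C = V - (S \<union> D)" using that by blast
      ultimately show ?thesis using cut_complement[OF simple] by metis
    qed
    have "incidence_vector (cut E S) = incidence_vector (cut E (A \<union> B))"
      using AB(1) cut_complement[OF simple] by metis
    also have "\<dots> = incidence_vector (cut E A) + incidence_vector (cut E B)"
      using AB by (intro incidence_cut_Un[OF simple])
    also have "\<dots> \<in> span (incidence_vector ` bonds V E)"
    proof (rule span_add)
      show "incidence_vector (cut E A) \<in> span (incidence_vector ` bonds V E)"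
        by (rule sub[of A B]) (use AB in auto)
      show "incidence_vector (cut E B) \<in> span (incidence_vector ` bonds V E)"
      proof (rule sub[of B A])
        show "{x, y} \<notin> E" if "x \<in> B" "y \<in> A" for x y
          using AB(5)[OF that(2,1)] by (simp add: insert_commute)
      qed (use AB in auto)
    qed
    finally show ?thesis .
  qed
qed

text \<open>Induction on the size of \<open>S\<close>: a disconnected \<open>S\<close> splits into
  smaller parts whose cuts add up, down to connected sets.\<close>

lemma incidence_cut_in_span_bonds:
  assumes "S \<subseteq> V"
  shows "incidence_vector (cut E S) \<in> span (incidence_vector ` bonds V E)"
  using assms
proof (induction "card S" arbitrary: S rule: less_induct)
  case less
  show ?case
  proof (cases "connected_graph S (induced_edges E S)")
    case True
    then show ?thesis using less.prems incidence_cut_connected_in_span_bonds by blast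
  next
    case False
    then obtain A B where AB: "A \<union> B = S" "A \<inter> B = {}" "A \<noteq> {}" "B \<noteq> {}"
      "\<And>x y. x \<in> A \<Longrightarrow> y \<in> B \<Longrightarrow> {x, y} \<notin> E"
      by (rule disconnected_splitE) blast
    then have "A \<subset> S" "B \<subset> S" by auto
    then have "card A < card S" "card B < card S"
      by (auto intro!: psubset_card_mono)
    then have "incidence_vector (cut E A) + incidence_vector (cut E B)
        \<in> span (incidence_vector ` bonds V E)"
      using less \<open>A \<subset> S\<close> \<open>B \<subset> S\<close> by (intro span_add) auto
    then show ?thesis
      using incidence_cut_Un[OF simple, of A B] AB by metis
  qed
qed

text \<open>Twice the unit vector of an edge \<open>uw\<close> is \<open>\<delta>(u) + \<delta>(w) - \<delta>({u, w})\<close>.\<close>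

lemma axis_in_span_bonds:
  assumes "e \<in> E"
  shows "axis e 1 \<in> span (incidence_vector ` bonds V E)"
proof -
  obtain u w where uw: "e = {u, w}" "u \<noteq> w" "u \<in> V" "w \<in> V"
    using assms simple simple_graph_edgeE by metis
  let ?d = "\<lambda>S. incidence_vector (cut E S)"
  have "axis e 1 $ d = ((1/2) *\<^sub>R (?d {u} + ?d {w} - ?d {u, w})) $ d" for d
  proof (cases "d \<in> E")
    case True
    then obtain x y where xy: "d = {x, y}" "x \<noteq> y"
      using simple simple_graph_edgeE by metis
    then show ?thesis
      using True uw(2)
      unfolding cut_def incidence_vector_def xy axis_def uw(1) doubleton_eq_iff
      by (simp add: card_doubleton_Int_eq_1_iff[OF xy(2), unfolded One_nat_def]) auto
  next
    case False
    then show ?thesis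
      using assms by (auto simp: cut_def incidence_vector_def axis_def)
  qed
  then have "axis e 1 = (1/2) *\<^sub>R (?d {u} + ?d {w} - ?d {u, w})"
    unfolding vec_eq_iff by blast
  also have "\<dots> \<in> span (incidence_vector ` bonds V E)"
    using uw by (intro span_scale span_add span_diff incidence_cut_in_span_bonds) auto
  finally show ?thesis .
qed

text \<open>The origin is the vector of the empty bond. Its presence makes the affine dimension of
  the polytope equal to its linear dimension.\<close>

lemma zero_in_bond_polytope: "0 \<in> bond_polytope V E"
proof -
  have "induced_edges E V = E"
    using simple by (auto simp: induced_edges_def simple_graph_def)
  then have "cut_is_bond V E {}"
    using connected by (simp add: cut_is_bond_def) (simp add: connected_graph_def)
  then have "cut E {} \<in> bonds V E" unfolding bonds_def by blast
  moreover have "incidence_vector (cut E {}) = 0"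
    by (simp add: vec_eq_iff incidence_vector_def cut_def)
  ultimately show ?thesis
    unfolding bond_polytope_def by (metis hull_inc imageI)
qed

text \<open>The unit vectors of the edges are independent and lie in the span of the bonds.\<close>

lemma aff_dim_bond_polytope_ge: "aff_dim (bond_polytope V E) \<ge> int (card E)"
proof -
  let ?A = "(\<lambda>e. axis e (1::real)) ` E"
  have "?A \<subseteq> Basis" by (auto simp: axis_in_Basis_iff)
  then have "independent ?A" by (rule independent_mono[OF independent_Basis])
  moreover have "card ?A = card E"
    by (intro card_image inj_onI) (simp add: axis_eq_axis)
  ultimately have "card E = dim ?A" by (simp add: dim_eq_card_independent)
  also have "\<dots> \<le> dim (span (incidence_vector ` bonds V E))"
    by (intro dim_subset) (use axis_in_span_bonds in blast)
  also have "\<dots> \<le> dim (bond_polytope V E)"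
    unfolding dim_span bond_polytope_def by (intro dim_subset hull_subset)
  finally show ?thesis
    using zero_in_bond_polytope by (simp add: aff_dim_zero hull_inc)
qed

end

lemma aff_dim_bond_polytope_le: "aff_dim (bond_polytope V E) \<le> int (card E)"
proof -
  let ?A = "(\<lambda>e. axis e (1::real)) ` E"
  have "incidence_vector D \<in> span ?A" if "D \<subseteq> E" for D
  proof -
    have "incidence_vector D = (\<Sum>e\<in>D. axis e 1)"
      by (simp add: vec_eq_iff incidence_vector_def axis_def)
    also have "\<dots> \<in> span ?A"
      using that by (intro span_sum span_base) auto
    finally show ?thesis .
  qed
  then have "incidence_vector ` bonds V E \<subseteq> span ?A"
    by (auto simp: bonds_def cut_def)
  then have "bond_polytope V E \<subseteq> span ?A"
    unfolding bond_polytope_def by (intro hull_minimal) (auto intro: subspace_imp_convex)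
  then have "aff_dim (bond_polytope V E) \<le> aff_dim (span ?A)" by (rule aff_dim_subset)
  also have "\<dots> = int (dim ?A)" by (simp add: aff_dim_subspace)
  also have "\<dots> \<le> int (card ?A)" by (simp add: dim_le_card')
  also have "\<dots> \<le> int (card E)" by (simp add: card_image_le)
  finally show ?thesis .
qed

section \<open>Linear functionals and dimension\<close>

text \<open>Extending the coefficients by zero outside \<open>E\<close> turns the inequality into a
  half-space of the ambient space, so that general facts on half-spaces and supporting hyperplanes
  apply.\<close>

lemma sum_coeff_eq_inner:
  fixes E :: "'v::finite set set"
  shows "(\<Sum>e\<in>E. a e * x $ e) = (\<chi> e. if e \<in> E then a e else 0) \<bullet> x"
  unfolding inner_vec_def
  by (intro sum.mono_neutral_cong_left) auto

lemma bond_polytope_le_iff: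
  "(\<forall>x\<in>bond_polytope V E. (\<Sum>e\<in>E. a e * x $ e) \<le> b) \<longleftrightarrow>
   (\<forall>S. cut_is_bond V E S \<longrightarrow> (\<Sum>e\<in>E. a e * incidence_vector (cut E S) $ e) \<le> b)"
proof
  assume *: "\<forall>S. cut_is_bond V E S \<longrightarrow> (\<Sum>e\<in>E. a e * incidence_vector (cut E S) $ e) \<le> b"
  have "bond_polytope V E \<subseteq> {x. (\<Sum>e\<in>E. a e * x $ e) \<le> b}"
    unfolding bond_polytope_def
  proof (rule hull_minimal)
    show "convex {x. (\<Sum>e\<in>E. a e * x $ e) \<le> b}"
      unfolding sum_coeff_eq_inner by (rule convex_halfspace_le)
  qed (use * in \<open>auto simp: bonds_def\<close>)
  then show "\<forall>x\<in>bond_polytope V E. (\<Sum>e\<in>E. a e * x $ e) \<le> b" by blast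
qed (auto simp: bond_polytope_def bonds_def intro: hull_inc)

lemma bond_polytope_nth_eq_0:
  assumes "x \<in> bond_polytope V E" "e \<notin> E"
  shows "x $ e = 0"
proof -
  have "bond_polytope V E \<subseteq> {x. x $ e = 0}"
    unfolding bond_polytope_def
  proof (rule hull_minimal)
    show "convex {x :: real ^ 'a set. x $ e = 0}"
      by (intro subspace_imp_convex) (auto simp: subspace_def)
  qed (use assms in \<open>auto simp: bonds_def incidence_vector_def cut_def\<close>)
  then show ?thesis using assms by blast
qed

text \<open>A linear equation that holds on \<open>S\<close> and fails at \<open>y\<close> certifies
  that \<open>y\<close> is affinely independent of \<open>S\<close>.\<close>

lemma aff_dim_insert_notin_subspace:
  fixes S :: "'a::euclidean_space set"
  assumes "subspace U" "S \<subseteq> U" "y \<notin> U"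
  shows "aff_dim (insert y S) = aff_dim S + 1"
proof -
  have "affine hull S \<subseteq> U"
    using assms by (intro hull_minimal subspace_imp_affine)
  then show ?thesis using assms by (auto simp: aff_dim_insert)
qed

section \<open>Replacing a vertex by a triangle\<close>

locale vertex_split =
  fixes V :: "'v::finite set" and E :: "'v set set" and v v1 v2 v3 :: 'v and f :: "'v \<Rightarrow> 'v"
  assumes simple: "simple_graph V E"
    and v_in: "v \<in> V"
    and new: "v1 \<notin> V" "v2 \<notin> V" "v3 \<notin> V"
    and distinct: "v1 \<noteq> v2" "v1 \<noteq> v3" "v2 \<noteq> v3"
    and f_in: "\<And>w. {v, w} \<in> E \<Longrightarrow> f w \<in> {v1, v2, v3}"
begin

abbreviation "T \<equiv> {v1, v2, v3}"
abbreviation "Tri \<equiv> triangle v1 v2 v3"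
abbreviation "V' \<equiv> split_verts V v v1 v2 v3"
abbreviation "E' \<equiv> split_edges E v v1 v2 v3 f"
abbreviation "\<phi> \<equiv> split_phi v v1 v2 v3"

lemma edge_subset: "e \<in> E \<Longrightarrow> e \<subseteq> V"
  using simple by (simp add: simple_graph_def)

lemma neighbour: "{v, w} \<in> E \<Longrightarrow> w \<in> V \<and> w \<noteq> v \<and> w \<notin> T"
  using simple new edge_subset[of "{v, w}"] by (auto simp: simple_graph_def)

lemma old_edge: "e \<in> E \<Longrightarrow> e \<inter> T = {} \<and> e \<notin> Tri \<and> \<phi> e = e"
  using edge_subset[of e] new by (auto simp: split_phi_def triangle_def)

lemma moved_edge:
  assumes "{v, w} \<in> E"
  shows "{f w, w} \<in> E' - Tri" "\<phi> {f w, w} = {v, w}"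
proof -
  have "w \<notin> T" "f w \<in> T" using assms neighbour f_in by blast+
  then show "{f w, w} \<in> E' - Tri"
    using assms by (auto simp: split_edges_def triangle_def doubleton_eq_iff)
  have "{f w, w} - T = {w}" "{f w, w} \<inter> T \<noteq> {}"
    using \<open>w \<notin> T\<close> \<open>f w \<in> T\<close> by blast+
  then show "\<phi> {f w, w} = {v, w}" unfolding split_phi_def by (simp only: if_False)
qed

lemma split_edge_cases [consumes 1, case_names triangle old moved]:
  assumes "e \<in> E'"
  obtains "e \<in> Tri" | "e \<in> E" "v \<notin> e" | w where "e = {f w, w}" "{v, w} \<in> E"
  using assms unfolding split_edges_def by blast

lemma Tri_subset: "Tri \<subseteq> E'"
  by (auto simp: split_edges_def)

text \<open>Non-triangle edges are either old edges avoiding \<open>v\<close>, which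
  \<open>\<phi>\<close> fixes, or of the form \<open>{f w, w}\<close>, sent to
  \<open>{v, w}\<close>. Since \<open>f\<close> picks a single triangle vertex for each neighbour,
  \<open>w\<close> determines the edge.\<close>

lemma bij_betw_phi: "bij_betw \<phi> (E' - Tri) E"
  unfolding bij_betw_def
proof
  have *: "(e \<in> E \<and> v \<notin> e \<and> \<phi> e = e) \<or> (\<exists>w. e = {f w, w} \<and> {v, w} \<in> E \<and> \<phi> e = {v, w})"
    if "e \<in> E' - Tri" for e
    using that old_edge moved_edge by (auto elim!: split_edge_cases)
  show "inj_on \<phi> (E' - Tri)"
  proof (rule inj_onI)
    fix d e assume "d \<in> E' - Tri" "e \<in> E' - Tri" "\<phi> d = \<phi> e"
    then show "d = e"
      using *[of d] *[of e] by (auto simp: doubleton_eq_iff)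
  qed
  show "\<phi> ` (E' - Tri) = E"
  proof
    show "\<phi> ` (E' - Tri) \<subseteq> E" using * by force
    show "E \<subseteq> \<phi> ` (E' - Tri)"
    proof
      fix e assume e: "e \<in> E"
      show "e \<in> \<phi> ` (E' - Tri)"
      proof (cases "v \<in> e")
        case True
        obtain x y where "e = {x, y}" using e simple simple_graph_edgeE by metis
        with True obtain w where "e = {v, w}" by blast
        then show ?thesis using e moved_edge[of w] by (metis image_eqI)
      next
        case False
        then have "e \<in> E' - Tri" using e old_edge by (auto simp: split_edges_def)
        then show ?thesis using e old_edge by (metis image_eqI)
      qed
    qed
  qed
qed

lemma card_split_edges: "card E' = card E + 3"
proof -
  have "card Tri = 3"
    using distinct by (simp add: triangle_def doubleton_eq_iff)
  moreover have "card (E' - Tri) = card E"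
    using bij_betw_phi by (rule bij_betw_same_card)
  moreover have "card E' = card (E' - Tri) + card Tri"
    using Tri_subset by (metis card_Diff_subset card_mono finite le_add_diff_inverse2)
  ultimately show ?thesis by simp
qed

lemma simple_graph_split: "simple_graph V' E'"
  unfolding simple_graph_def
proof (intro conjI ballI)
  fix e assume "e \<in> E'"
  then have "e \<subseteq> V' \<and> card e = 2"
  proof (cases rule: split_edge_cases)
    case triangle
    then show ?thesis using distinct by (auto simp: triangle_def split_verts_def)
  next
    case old
    then show ?thesis using simple by (auto simp: simple_graph_def split_verts_def)
  next
    case (moved w)
    then have "w \<noteq> f w" "w \<in> V" "w \<noteq> v" "f w \<in> T" using neighbour[of w] f_in[of w] by auto
    then show ?thesis using moved by (auto simp: split_verts_def)
  qed
  then show "e \<subseteq> V'" "card e = 2" by auto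
qed simp

lemma phi_Int:
  assumes "S \<subseteq> V - {v}"
  shows "\<phi> e \<inter> S = e \<inter> S"
proof -
  have "S \<inter> T = {}" "v \<notin> S" using assms new by auto
  then show ?thesis by (auto simp: split_phi_def)
qed

text \<open>A set avoiding \<open>v\<close> lies off the triangle, so it cuts no triangle edge, and
  \<open>\<phi>\<close> leaves the intersection of an edge with it unchanged.\<close>

lemma cut_split:
  assumes "S \<subseteq> V - {v}"
  shows "cut E' S = {e \<in> E' - Tri. \<phi> e \<in> cut E S}"
proof -
  have "S \<inter> T = {}" using assms new by auto
  then have "e \<inter> S = {}" if "e \<in> Tri" for e using that by (auto simp: triangle_def)
  then have "e \<notin> cut E' S" if "e \<in> Tri" for e using that by (simp add: cut_def)
  moreover have "\<phi> e \<in> E" if "e \<in> E' - Tri" for e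
    using that bij_betw_phi by (auto simp: bij_betw_def)
  ultimately show ?thesis
    using phi_Int[OF assms] by (fastforce simp: cut_def)
qed

text \<open>The whole triangle lies on the side of the complement and is itself connected, so
  contracting or expanding it preserves connectedness.\<close>

lemma connected_complement_split_iff:
  assumes "S \<subseteq> V - {v}"
  shows "connected_graph (V' - S) (induced_edges E' (V' - S))
    \<longleftrightarrow> connected_graph (V - S) (induced_edges E (V - S))"
    (is "connected_graph _ ?F' \<longleftrightarrow> connected_graph _ ?F")
proof
  have ST: "S \<inter> T = {}" "v \<notin> S" using assms new by auto
  let ?R = "{(x, y). {x, y} \<in> ?F}" and ?Q = "{(x, y). {x, y} \<in> ?F'}"
  {
    \<comment> \<open>Contraction: triangle edges collapse to the point \<open>v\<close>, and all
      other edges map to edges.\<close>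
    let ?h = "\<lambda>x. if x \<in> T then v else x"
    assume "connected_graph (V' - S) ?F'"
    then show "connected_graph (V - S) ?F"
    proof (rule connected_graph_transfer[where h = ?h])
      fix x y assume xy: "{x, y} \<in> ?F'"
      then have "{x, y} \<in> E'" by (simp add: induced_edges_def)
      then show "(?h x, ?h y) \<in> ?R\<^sup>*"
      proof (cases rule: split_edge_cases)
        case triangle
        then have "x \<in> T" "y \<in> T" by (auto simp: triangle_def doubleton_eq_iff)
        then show ?thesis by simp
      next
        case old
        then have "?h x = x" "?h y = y" using old_edge[of "{x, y}"] by auto
        moreover have "{x, y} \<in> ?F"
          using old xy edge_subset by (auto simp: induced_edges_def)
        ultimately show ?thesis by auto
      next
        case (moved w)
        then have w: "f w \<in> T" "w \<notin> T" "w \<in> V" using f_in neighbour by blast+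
        have "w \<notin> S" using xy moved by (auto simp: induced_edges_def)
        then have "{v, w} \<in> ?F" "{w, v} \<in> ?F"
          using moved w ST v_in by (auto simp: induced_edges_def insert_commute)
        moreover have "(?h x = v \<and> ?h y = w) \<or> (?h x = w \<and> ?h y = v)"
          using moved(1) w by (auto simp: doubleton_eq_iff)
        ultimately show ?thesis by auto
      qed
    next
      fix z assume z: "z \<in> V - S"
      show "\<exists>x\<in>V' - S. (z, ?h x) \<in> ?R\<^sup>*"
      proof (cases "z = v")
        case True
        then have "v1 \<in> V' - S" "(z, ?h v1) \<in> ?R\<^sup>*"
          using ST by (auto simp: split_verts_def)
        then show ?thesis by blast
      next
        case False
        then have "z \<in> V' - S" "?h z = z"
          using z new by (auto simp: split_verts_def)
        then show ?thesis by (intro bexI[of _ z]) simp_all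
      qed
    qed
  }
  {
    \<comment> \<open>Expansion, with \<open>v1\<close> representing \<open>v\<close>: an edge
      \<open>{v, w}\<close> becomes a walk from \<open>v1\<close> through the triangle to
      \<open>f w\<close> and on to \<open>w\<close>.\<close>
    let ?h = "\<lambda>x. if x = v then v1 else x"
    assume "connected_graph (V - S) ?F"
    have TQ: "(s, t) \<in> ?Q\<^sup>*" if "s \<in> T" "t \<in> T" for s t
    proof (cases "s = t")
      case False
      then have "{s, t} \<in> Tri" using that by (auto simp: triangle_def insert_commute)
      then have "{s, t} \<in> ?F'"
        using that ST Tri_subset by (auto simp: induced_edges_def split_verts_def)
      then show ?thesis by auto
    qed simp
    have vQ: "(v1, w) \<in> ?Q\<^sup>*" "(w, v1) \<in> ?Q\<^sup>*" if "{v, w} \<in> ?F" for w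
    proof -
      have w: "{v, w} \<in> E" "w \<notin> S" using that by (auto simp: induced_edges_def)
      then have fw: "f w \<in> T" "w \<in> V" "w \<noteq> v" using f_in neighbour by blast+
      then have "f w \<notin> S" "f w \<in> V'" using ST by (auto simp: split_verts_def)
      then have "{f w, w} \<in> ?F'"
        using moved_edge(1)[OF w(1)] fw w by (auto simp: induced_edges_def split_verts_def)
      then have "(f w, w) \<in> ?Q" "(w, f w) \<in> ?Q" by (auto simp: insert_commute)
      moreover have "(v1, f w) \<in> ?Q\<^sup>*" "(f w, v1) \<in> ?Q\<^sup>*" using TQ fw by auto
      ultimately show "(v1, w) \<in> ?Q\<^sup>*" "(w, v1) \<in> ?Q\<^sup>*"
        by (meson rtrancl_into_rtrancl converse_rtrancl_into_rtrancl)+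
    qed
    from \<open>connected_graph (V - S) ?F\<close> show "connected_graph (V' - S) ?F'"
    proof (rule connected_graph_transfer[where h = ?h])
      fix x y assume xy: "{x, y} \<in> ?F"
      show "(?h x, ?h y) \<in> ?Q\<^sup>*"
      proof (cases "x = v \<or> y = v")
        case True
        then show ?thesis using xy vQ[of x] vQ[of y] by (auto simp: insert_commute)
      next
        case False
        then have "{x, y} \<in> ?F'"
          using xy by (auto simp: induced_edges_def split_edges_def split_verts_def)
        then show ?thesis using False by auto
      qed
    next
      fix z assume z: "z \<in> V' - S"
      show "\<exists>x\<in>V - S. (z, ?h x) \<in> ?Q\<^sup>*"
      proof (cases "z \<in> T")
        case True
        then have "(z, ?h v) \<in> ?Q\<^sup>*" using TQ by simp
        then show ?thesis using v_in ST by blast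
      next
        case False
        then have "z \<in> V - S" "?h z = z" using z by (auto simp: split_verts_def)
        then show ?thesis by (intro bexI[of _ z]) simp_all
      qed
    qed
  }
qed

text \<open>Both graphs have the same edges inside \<open>S\<close>, since these meet neither
  \<open>v\<close> nor the triangle; only the complement changes.\<close>

lemma cut_is_bond_split_iff:
  assumes "S \<subseteq> V - {v}"
  shows "cut_is_bond V' E' S \<longleftrightarrow> cut_is_bond V E S"
proof -
  have ST: "S \<inter> T = {}" "v \<notin> S" using assms new by auto
  have "induced_edges E' S = induced_edges E S"
  proof
    show "induced_edges E' S \<subseteq> induced_edges E S"
    proof
      fix e assume "e \<in> induced_edges E' S"
      then have "e \<in> E'" "e \<subseteq> S" by (auto simp: induced_edges_def)
      then show "e \<in> induced_edges E S"
      proof (cases rule: split_edge_cases)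
        case triangle
        then show ?thesis using \<open>e \<subseteq> S\<close> ST by (auto simp: triangle_def)
      next
        case old
        then show ?thesis using \<open>e \<subseteq> S\<close> by (simp add: induced_edges_def)
      next
        case (moved w)
        then show ?thesis using \<open>e \<subseteq> S\<close> ST f_in[of w] by auto
      qed
    qed
    show "induced_edges E S \<subseteq> induced_edges E' S"
      using ST by (auto simp: induced_edges_def split_edges_def)
  qed
  moreover have "S \<subseteq> V" "S \<subseteq> V'" using assms by (auto simp: split_verts_def)
  ultimately show ?thesis
    unfolding cut_is_bond_def connected_complement_split_iff[OF assms] by simp
qed

text \<open>Pullback along \<open>\<phi>\<close>, extended by zero on the triangle. It is linear and
  takes the cut vector of a set avoiding \<open>v\<close> to that of the same set in the split
  graph.\<close>

definition lift :: "real ^ 'v set \<Rightarrow> real ^ 'v set" where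
  "lift x = (\<chi> e. if e \<in> E' - Tri then x $ \<phi> e else 0)"

lemma linear_lift: "linear lift"
  by (rule linearI) (simp_all add: lift_def vec_eq_iff)

lemma lift_incidence_cut:
  assumes "S \<subseteq> V - {v}"
  shows "lift (incidence_vector (cut E S)) = incidence_vector (cut E' S)"
  by (simp add: vec_eq_iff lift_def incidence_vector_def cut_split[OF assms])

lemma lift_in_bond_polytope:
  assumes "x \<in> bond_polytope V E"
  shows "lift x \<in> bond_polytope V' E'"
proof -
  have "lift ` incidence_vector ` bonds V E \<subseteq> incidence_vector ` bonds V' E'"
  proof clarify
    fix D assume "D \<in> bonds V E"
    then obtain S where S: "D = cut E S" "cut_is_bond V E S"
      unfolding bonds_def by blast
    \<comment> \<open>The side of the bond that avoids \<open>v\<close>.\<close>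
    define U where "U = (if v \<in> S then V - S else S)"
    have U: "D = cut E U" "cut_is_bond V E U"
      using S cut_complement[OF simple] cut_is_bond_complement by (auto simp: U_def)
    moreover have "U \<subseteq> V - {v}"
      using S v_in by (auto simp: U_def cut_is_bond_def)
    ultimately have "lift (incidence_vector D) = incidence_vector (cut E' U)"
      and "cut_is_bond V' E' U"
      using lift_incidence_cut cut_is_bond_split_iff by auto
    then show "lift (incidence_vector D) \<in> incidence_vector ` bonds V' E'"
      unfolding bonds_def by auto
  qed
  then have "lift ` bond_polytope V E \<subseteq> bond_polytope V' E'"
    unfolding bond_polytope_def convex_hull_linear_image[OF linear_lift] by (rule hull_mono)
  then show ?thesis using assms by blast
qed

lemma sum_lift:
  assumes "\<And>e. e \<notin> Tri \<Longrightarrow> a' e = a (\<phi> e)"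
  shows "(\<Sum>e\<in>E'. a' e * lift x $ e) = (\<Sum>e\<in>E. a e * x $ e)"
proof -
  have "(\<Sum>e\<in>E'. a' e * lift x $ e) = (\<Sum>e\<in>E' - Tri. a (\<phi> e) * x $ \<phi> e)"
    by (intro sum.mono_neutral_cong_right) (auto simp: lift_def assms)
  also have "\<dots> = (\<Sum>e\<in>E. a e * x $ e)"
    by (rule sum.reindex_bij_betw[OF bij_betw_phi])
  finally show ?thesis .
qed

text \<open>On the polytope \<open>lift\<close> has a linear left inverse \<open>r\<close>, namely
  pullback along the inverse of \<open>\<phi>\<close>, and linear maps do not raise dimension.
  Points of the polytope vanish outside \<open>E\<close>, so \<open>r\<close> recovers them
  completely.\<close>

lemma aff_dim_le_lift_image:
  assumes "F \<subseteq> bond_polytope V E"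
  shows "aff_dim F \<le> aff_dim (lift ` F)"
proof -
  define r :: "real ^ 'v set \<Rightarrow> real ^ 'v set"
    where "r = (\<lambda>y. \<chi> e. if e \<in> E then y $ inv_into (E' - Tri) \<phi> e else 0)"
  have "linear r"
    by (rule linearI) (simp_all add: r_def vec_eq_iff)
  have "r (lift x) = x" if "x \<in> bond_polytope V E" for x
  proof -
    have "inv_into (E' - Tri) \<phi> e \<in> E' - Tri \<and> \<phi> (inv_into (E' - Tri) \<phi> e) = e" if "e \<in> E" for e
      using that bij_betw_phi by (metis bij_betw_def f_inv_into_f inv_into_into)
    then show ?thesis
      using bond_polytope_nth_eq_0[OF that] by (auto simp: r_def lift_def vec_eq_iff)
  qed
  then have "r ` lift ` F = F" using assms by force
  then show ?thesis using aff_dim_linear_image_le[OF \<open>linear r\<close>] by metis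
qed

lemma triangle_nth:
  "incidence_vector (cut E' S) $ {v1, v2} = (if (v1 \<in> S) \<noteq> (v2 \<in> S) then 1 else 0)"
  "incidence_vector (cut E' S) $ {v1, v3} = (if (v1 \<in> S) \<noteq> (v3 \<in> S) then 1 else 0)"
  "incidence_vector (cut E' S) $ {v2, v3} = (if (v2 \<in> S) \<noteq> (v3 \<in> S) then 1 else 0)"
  using Tri_subset distinct by (simp_all only: incidence_cut_nth triangle_def insert_subset simp_thms)

text \<open>Separates the triangle terms, on which the weights of the maximisation are zero, from
  those where both coefficient functions agree.\<close>

lemma sum_cut_eq:
  fixes S :: "'v set"
  assumes "\<And>e. e \<notin> Tri \<Longrightarrow> a' e = a (\<phi> e)"
  defines "x \<equiv> incidence_vector (cut E' S)"
  shows "(\<Sum>e\<in>E'. a' e * x $ e) = cut_weight E' (split_weight v v1 v2 v3 a) S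
    + (a' {v1, v2} * x $ {v1, v2} + a' {v1, v3} * x $ {v1, v3} + a' {v2, v3} * x $ {v2, v3})"
proof -
  have "cut_weight E' (split_weight v v1 v2 v3 a) S = (\<Sum>e\<in>E' - Tri. a' e * x $ e)"
    unfolding cut_weight_def
    by (rule sum.mono_neutral_cong)
      (auto simp: x_def assms(1) split_weight_def incidence_vector_def cut_def)
  moreover have "(\<Sum>e\<in>Tri. a' e * x $ e)
      = a' {v1, v2} * x $ {v1, v2} + a' {v1, v3} * x $ {v1, v3} + a' {v2, v3} * x $ {v2, v3}"
    using distinct by (simp add: triangle_def doubleton_eq_iff)
  moreover have "(\<Sum>e\<in>E'. a' e * x $ e) = (\<Sum>e\<in>E' - Tri. a' e * x $ e) + (\<Sum>e\<in>Tri. a' e * x $ e)"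
    using Tri_subset by (intro sum.subset_diff) auto
  ultimately show ?thesis by simp
qed

lemma Int_T_singletonD:
  "S \<inter> T = {v1} \<Longrightarrow> v1 \<in> S \<and> v2 \<notin> S \<and> v3 \<notin> S"
  "S \<inter> T = {v2} \<Longrightarrow> v1 \<notin> S \<and> v2 \<in> S \<and> v3 \<notin> S"
  "S \<inter> T = {v3} \<Longrightarrow> v1 \<notin> S \<and> v2 \<notin> S \<and> v3 \<in> S"
  using distinct unfolding set_eq_iff Int_iff insert_iff empty_iff by metis+

lemma bond_split_cases [consumes 1, case_names avoid separate]:
  assumes "cut_is_bond V' E' S"
  obtains U where "cut E' S = cut E' U" "cut_is_bond V E U" "U \<subseteq> V - {v}"
  | U i where "cut E' S = cut E' U" "cut_is_bond V' E' U" "i \<in> T" "U \<inter> T = {i}"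
proof -
  \<comment> \<open>Of the three triangle vertices one side of the cut contains at most one;
    \<open>U\<close> is that side.\<close>
  define U where "U = (if card (S \<inter> T) \<le> 1 then S else V' - S)"
  have U: "cut E' S = cut E' U" "cut_is_bond V' E' U"
    using assms cut_complement[OF simple_graph_split] cut_is_bond_complement
    by (auto simp: U_def)
  have "T \<subseteq> V'" by (auto simp: split_verts_def)
  then have "(V' - S) \<inter> T = T - S \<inter> T" by blast
  then have "card ((V' - S) \<inter> T) = 3 - card (S \<inter> T)"
    using distinct by (simp add: card_Diff_subset)
  then have "card (U \<inter> T) \<le> 1" unfolding U_def by (cases "card (S \<inter> T) \<le> 1") simp_all
  then have "card (U \<inter> T) = 0 \<or> card (U \<inter> T) = 1" by linarith
  then consider "U \<inter> T = {}" | i where "U \<inter> T = {i}"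
    unfolding card_1_singleton_iff One_nat_def by auto
  then show thesis
  proof cases
    case 1
    then have "U \<subseteq> V - {v}"
      using U(2) v_in new unfolding cut_is_bond_def split_verts_def by blast
    then show thesis using that(1) U cut_is_bond_split_iff by blast
  next
    case 2
    then have "i \<in> T" by blast
    then show thesis using that(2) U 2 by blast
  qed
qed

end

theorem theorem4p2:
  fixes V V' :: "'v::finite set" and E E' :: "'v set set"
    and v v1 v2 v3 :: 'v and f :: "'v \<Rightarrow> 'v"
    and a c :: "'v set \<Rightarrow> real" and b \<omega>1 \<omega>2 \<omega>3 :: real
    and S1 S2 S3 :: "'v set"
  assumes "simple_graph V E" and "connected_graph V E" and "v \<in> V"
    and "facet_defining V E a b"
    and "v1 \<notin> V" and "v2 \<notin> V" and "v3 \<notin> V" and "v1 \<noteq> v2" and "v1 \<noteq> v3" and "v2 \<noteq> v3"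
    and "\<And>w. {v, w} \<in> E \<Longrightarrow> f w \<in> {v1, v2, v3}"
    and "V' = split_verts V v v1 v2 v3"
    and "E' = split_edges E v v1 v2 v3 f"
    and "c = split_weight v v1 v2 v3 a"
    and "is_arg_max (cut_weight E' c)
           (\<lambda>S. S \<inter> {v1, v2, v3} = {v1} \<and> cut_is_bond V' E' S) S1"
    and "is_arg_max (cut_weight E' c)
           (\<lambda>S. S \<inter> {v1, v2, v3} = {v2} \<and> cut_is_bond V' E' S) S2"
    and "is_arg_max (cut_weight E' c)
           (\<lambda>S. S \<inter> {v1, v2, v3} = {v3} \<and> cut_is_bond V' E' S) S3"
    and "\<omega>1 = cut_weight E' c S1" and "\<omega>2 = cut_weight E' c S2" and "\<omega>3 = cut_weight E' c S3"
  shows "facet_defining V' E' (lifted_coeff v v1 v2 v3 a b \<omega>1 \<omega>2 \<omega>3) b"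
proof -
  interpret vertex_split V E v v1 v2 v3 f
    by unfold_locales (use assms in auto)
  note V'_eq [simp] = assms(12) and E'_eq [simp] = assms(13) and c_eq [simp] = assms(14)
  define a' where "a' = lifted_coeff v v1 v2 v3 a b \<omega>1 \<omega>2 \<omega>3"
  define l where "l = (\<lambda>x. \<Sum>e\<in>E. a e * x $ e)"
  define l' where "l' = (\<lambda>x. \<Sum>e\<in>E'. a' e * x $ e)"
  let ?P = "bond_polytope V E" and ?P' = "bond_polytope V' E'"
  define F where "F = {x \<in> ?P. l x = b}"
  define F' where "F' = {x \<in> ?P'. l' x = b}"
  have a'_off: "a' e = a (\<phi> e)" if "e \<notin> Tri" for e
    using that by (auto simp: a'_def lifted_coeff_def triangle_def)
  \<comment> \<open>These values are the solution of the three linear equations requiring the two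
    triangle edges at each \<open>v_i\<close> to have coefficients summing to
    \<open>b - \<omega>i\<close>.\<close>
  have a'_Tri: "a' {v1, v2} = (b - \<omega>1 - \<omega>2 + \<omega>3) / 2" "a' {v1, v3} = (b - \<omega>1 + \<omega>2 - \<omega>3) / 2"
    "a' {v2, v3} = (b + \<omega>1 - \<omega>2 - \<omega>3) / 2"
    using distinct by (auto simp: a'_def lifted_coeff_def doubleton_eq_iff)
  have valid: "\<forall>x\<in>?P. l x \<le> b" and facet: "F facet_of ?P"
    using assms(4) by (auto simp: facet_defining_def l_def F_def)
  have l'_lift: "l' (lift x) = l x" for x
    unfolding l_def l'_def E'_eq by (rule sum_lift) (rule a'_off)

  have l'_cut: "l' (incidence_vector (cut E' S)) = cut_weight E' c S
      + ((if (v1 \<in> S) \<noteq> (v2 \<in> S) then a' {v1, v2} else 0)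
       + (if (v1 \<in> S) \<noteq> (v3 \<in> S) then a' {v1, v3} else 0)
       + (if (v2 \<in> S) \<noteq> (v3 \<in> S) then a' {v2, v3} else 0))" for S
    using sum_cut_eq[of a' a S] a'_off unfolding l'_def E'_eq c_eq triangle_nth by simp
  have l'_separate1: "l' (incidence_vector (cut E' S)) = cut_weight E' c S + b - \<omega>1"
    if "S \<inter> T = {v1}" for S
    using Int_T_singletonD(1)[OF that] unfolding l'_cut a'_Tri by (simp add: field_simps)
  have l'_separate2: "l' (incidence_vector (cut E' S)) = cut_weight E' c S + b - \<omega>2"
    if "S \<inter> T = {v2}" for S
    using Int_T_singletonD(2)[OF that] unfolding l'_cut a'_Tri by (simp add: field_simps)
  have l'_separate3: "l' (incidence_vector (cut E' S)) = cut_weight E' c S + b - \<omega>3"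
    if "S \<inter> T = {v3}" for S
    using Int_T_singletonD(3)[OF that] unfolding l'_cut a'_Tri by (simp add: field_simps)

  have S: "S1 \<inter> T = {v1}" "cut_is_bond V' E' S1" "S2 \<inter> T = {v2}" "cut_is_bond V' E' S2"
    "S3 \<inter> T = {v3}" "cut_is_bond V' E' S3"
    using assms(15-17) by (auto simp: is_arg_max_def)
  have max1: "cut_weight E' c S \<le> \<omega>1" if "S \<inter> T = {v1}" "cut_is_bond V' E' S" for S
    using assms(15) that unfolding is_arg_max_linorder assms(18) by blast
  have max2: "cut_weight E' c S \<le> \<omega>2" if "S \<inter> T = {v2}" "cut_is_bond V' E' S" for S
    using assms(16) that unfolding is_arg_max_linorder assms(19) by blast
  have max3: "cut_weight E' c S \<le> \<omega>3" if "S \<inter> T = {v3}" "cut_is_bond V' E' S" for S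
    using assms(17) that unfolding is_arg_max_linorder assms(20) by blast

  have "l' (incidence_vector (cut E' S)) \<le> b" if "cut_is_bond V' E' S" for S
  proof -
    from that have "cut_is_bond (split_verts V v v1 v2 v3) (split_edges E v v1 v2 v3 f) S"
      by simp
    then show ?thesis
    proof (cases rule: bond_split_cases)
      \<comment> \<open>The cut vector is the lift of a bond vector of \<open>G\<close>, so validity
        of the original inequality bounds it.\<close>
      case (avoid U)
      then have "incidence_vector (cut E U) \<in> ?P"
        by (auto simp: bond_polytope_def bonds_def intro: hull_inc)
      then have "l (incidence_vector (cut E U)) \<le> b" using valid by blast
      then show ?thesis
        using avoid l'_lift[of "incidence_vector (cut E U)"] lift_incidence_cut by simp
    next
      \<comment> \<open>The value is the weight of \<open>U\<close> plus
        \<open>b - \<omega>i\<close>, and maximality of \<open>\<omega>i\<close> bounds that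
        weight.\<close>
      case (separate U i)
      have U: "cut E' S = cut E' U" "cut_is_bond V' E' U" using separate(1,2) by simp_all
      consider "i = v1" | "i = v2" | "i = v3" using separate(3) by blast
      then show ?thesis
      proof cases
        case 1
        then show ?thesis using l'_separate1 max1 U separate(4) by fastforce
      next
        case 2
        then show ?thesis using l'_separate2 max2 U separate(4) by fastforce
      next
        case 3
        then show ?thesis using l'_separate3 max3 U separate(4) by fastforce
      qed
    qed
  qed
  then have valid': "\<forall>x\<in>?P'. l' x \<le> b"
    unfolding l'_def bond_polytope_le_iff by blast

  have "convex ?P'" by (simp add: bond_polytope_def)
  then have face: "F' face_of ?P'"
    using face_of_Int_supporting_hyperplane_le[of ?P' "\<chi> e. if e \<in> E' then a' e else 0" b] valid'
    unfolding F'_def l'_def sum_coeff_eq_inner by (simp add: Collect_conj_eq)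
  have lift_F: "lift ` F \<subseteq> F'"
    using lift_in_bond_polytope l'_lift by (auto simp: F_def F'_def)

  let ?y1 = "incidence_vector (cut E' S1)" and ?y2 = "incidence_vector (cut E' S2)"
    and ?y3 = "incidence_vector (cut E' S3)"
  have y_P: "?y1 \<in> ?P'" "?y2 \<in> ?P'" "?y3 \<in> ?P'"
    using S unfolding bond_polytope_def bonds_def by (auto intro!: hull_inc)
  have y_F: "?y1 \<in> F'" "?y2 \<in> F'" "?y3 \<in> F'"
    using y_P l'_separate1[OF S(1)] l'_separate2[OF S(3)] l'_separate3[OF S(5)] assms(18-20)
    by (simp_all add: F'_def)
  have y_nth: "?y1 $ {v1, v2} = 1" "?y1 $ {v1, v3} = 1" "?y1 $ {v2, v3} = 0"
    "?y2 $ {v1, v2} = 1" "?y2 $ {v1, v3} = 0" "?y2 $ {v2, v3} = 1"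
    "?y3 $ {v1, v2} = 0" "?y3 $ {v1, v3} = 1" "?y3 $ {v2, v3} = 1"
    using Int_T_singletonD(1)[OF S(1)] Int_T_singletonD(2)[OF S(3)] Int_T_singletonD(3)[OF S(5)]
    by (simp_all add: triangle_nth)
  have lift_nth: "lift x $ {v1, v2} = 0" "lift x $ {v1, v3} = 0" "lift x $ {v2, v3} = 0" for x
    by (simp_all add: lift_def triangle_def)

  have "int (card E) - 1 \<le> aff_dim ?P - 1"
    using aff_dim_bond_polytope_ge[OF assms(1,2)] by simp
  also have "\<dots> = aff_dim F" using facet by (simp add: facet_of_def)
  also have "\<dots> \<le> aff_dim (lift ` F)"
    by (rule aff_dim_le_lift_image) (simp add: F_def)
  finally have "int (card E') - 1 \<le> aff_dim (lift ` F) + 3"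
    by (simp add: card_split_edges)
  also have "\<dots> = aff_dim (insert ?y1 (lift ` F)) + 2"
  proof -
    have "aff_dim (insert ?y1 (lift ` F)) = aff_dim (lift ` F) + 1"
      \<comment> \<open>Lifts vanish on the triangle, while \<open>S1\<close> cuts
        \<open>{v1, v2}\<close>.\<close>
      by (rule aff_dim_insert_notin_subspace[where U = "{x. x $ {v1, v2} = 0}"])
        (use lift_nth y_nth in \<open>auto simp: subspace_def\<close>)
    then show ?thesis by simp
  qed
  also have "\<dots> = aff_dim (insert ?y2 (insert ?y1 (lift ` F))) + 1"
  proof -
    have "aff_dim (insert ?y2 (insert ?y1 (lift ` F))) = aff_dim (insert ?y1 (lift ` F)) + 1"
      \<comment> \<open>\<open>S1\<close> does not cut \<open>{v2, v3}\<close>, but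
        \<open>S2\<close> does.\<close>
      by (rule aff_dim_insert_notin_subspace[where U = "{x. x $ {v2, v3} = 0}"])
        (use lift_nth y_nth in \<open>auto simp: subspace_def\<close>)
    then show ?thesis by simp
  qed
  also have "\<dots> = aff_dim (insert ?y3 (insert ?y2 (insert ?y1 (lift ` F))))"
    \<comment> \<open>On the triangle the equation reads 0 = 0 + 0 for lifts, 1 = 1 + 0 for
      \<open>S1\<close> and 1 = 0 + 1 for \<open>S2\<close>, but 0 = 1 + 1 for \<open>S3\<close>,
      where it fails.\<close>
    by (rule aff_dim_insert_notin_subspace[symmetric,
          where U = "{x. x $ {v1, v2} = x $ {v1, v3} + x $ {v2, v3}}"])
      (use lift_nth y_nth in \<open>auto simp: subspace_def algebra_simps\<close>)
  also have "\<dots> \<le> aff_dim F'"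
    using lift_F y_F by (intro aff_dim_subset) auto
  finally have lower: "int (card E') - 1 \<le> aff_dim F'" .

  \<comment> \<open>The lift of a point off \<open>F\<close> shows that \<open>F'\<close> is a
    proper face. The bounds \<open>card E' - 1 \<le> aff_dim F'\<close> and
    \<open>aff_dim ?P' \<le> card E'\<close> then leave a drop of exactly one.\<close>
  have "F \<noteq> ?P" using facet by (auto simp: facet_of_def)
  then obtain x where "x \<in> ?P" "l x \<noteq> b" unfolding F_def by blast
  then have "lift x \<in> ?P'" "lift x \<notin> F'"
    using lift_in_bond_polytope l'_lift by (auto simp: F'_def)
  then have "F' \<noteq> ?P'" by blast
  then have "aff_dim F' < aff_dim ?P'"
    using face \<open>convex ?P'\<close> by (intro face_of_aff_dim_lt)
  moreover have "aff_dim ?P' \<le> int (card E')" by (rule aff_dim_bond_polytope_le)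
  ultimately have "aff_dim F' = aff_dim ?P' - 1" using lower by simp
  then have "F' facet_of ?P'"
    \<comment> \<open>The three tight bonds also show that the face is nonempty, as a facet must
      be.\<close>
    using face y_F by (auto simp: facet_of_def)
  then show ?thesis
    using valid' unfolding facet_defining_def F'_def l'_def a'_def by blast
qed

end
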